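(* For positive integers $n$: (i) a $2$-divisible set of points over $\mathbb{F}_2$ of cardinality $n$ exists for all $n\ge 3$ and does not exist for $n\in\{1,2\}$; in particular $\mathrm{F}(2,1)=2$. (ii) A $4$-divisible set of points over $\mathbb{F}_2$ of cardinality $n$ exists if and only if $n\in\{7,8\}$ or $n\ge 14$; in particular $\mathrm{F}(2,2)=13$. (iii) An $8$-divisible set of points over $\mathbb{F}_2$ of cardinality $n$ exists for $n\in\{15,16,30,31,32,45,46,47,48,49,50,51\}$ and for all $n\ge 60$, and does not exist for every other positive $n$ except possibly $n=59$; thus $\mathrm{F}(2,3)\in\{58,59\}$.
   Context: A set of points over $\mathbb{F}_q$ means a set of $1$-dimensional subspaces of $\mathbb{F}_q^v$ for some $v\ge1$; hyperplanes are the $(v-1)$-dimensional subspaces. For an integer $\Delta>1$, such a set $\mathcal{C}$ is $\Delta$-divisible if $|\mathcal{C}\cap H|\equiv|\mathcal{C}|\pmod\Delta$ for every hyperplane $H$, where $\mathcal{C}\cap H$ is the set of points of $\mathcal{C}$ contained in $H$ (this property does not depend on the choice of ambient $v$ containing the span of $\mathcal{C}$). $\mathrm{F}(q,r)$ denotes the smallest positive integer such that a $q^r$-divisible set of points over $\mathbb{F}_q$ of cardinality $n$ exists for every integer $n>\mathrm{F}(q,r)$. *)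

theory Defs
  imports
    Complex_Main
    "HOL-Library.Function_Algebras"
    "HOL-Library.Cardinality"
    "HOL-Number_Theory.Cong"
begin

text \<open>
  The dimension \<open>v\<close> has to be quantified over, so the space of \<open>v\<close>-tuples is rendered as the
  sequences that vanish from index \<open>v\<close> on, inside the vector space of all sequences.  The field with
  \<open>q\<close> elements is a type \<open>'a\<close> of sort \<open>{field, finite}\<close> with \<open>CARD('a) = q\<close>.
\<close>

definition seq_scale :: "'a::field \<Rightarrow> (nat \<Rightarrow> 'a) \<Rightarrow> nat \<Rightarrow> 'a" where
  "seq_scale c x = (\<lambda>i. c * x i)"

global_interpretation seq: vector_space "seq_scale :: 'a::field \<Rightarrow> (nat \<Rightarrow> 'a) \<Rightarrow> nat \<Rightarrow> 'a"
  by unfold_locales (simp_all add: seq_scale_def fun_eq_iff algebra_simps)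

definition tuple_space :: "nat \<Rightarrow> (nat \<Rightarrow> 'a::field) set" where
  "tuple_space v = {x. \<forall>i\<ge>v. x i = 0}"

definition subspaces_of_dim :: "nat \<Rightarrow> nat \<Rightarrow> (nat \<Rightarrow> 'a::field) set set" where
  "subspaces_of_dim v k = {U. U \<subseteq> tuple_space v \<and> seq.subspace U \<and> seq.dim U = k}"

definition points :: "nat \<Rightarrow> (nat \<Rightarrow> 'a::field) set set" where
  "points v = subspaces_of_dim v 1"

definition hyperplanes :: "nat \<Rightarrow> (nat \<Rightarrow> 'a::field) set set" where
  "hyperplanes v = subspaces_of_dim v (v - 1)"

definition divisible :: "nat \<Rightarrow> nat \<Rightarrow> (nat \<Rightarrow> 'a::{field,finite}) set set \<Rightarrow> bool" where
  "divisible v \<Delta> C \<longleftrightarrow> (\<forall>H\<in>hyperplanes v. [card {P \<in> C. P \<subseteq> H} = card C] (mod \<Delta>))"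

definition divisible_set_exists :: "'a::{field,finite} itself \<Rightarrow> nat \<Rightarrow> nat \<Rightarrow> bool" where
  "divisible_set_exists T \<Delta> n \<longleftrightarrow>
     (\<exists>v\<ge>1. \<exists>C :: (nat \<Rightarrow> 'a) set set. C \<subseteq> points v \<and> card C = n \<and> divisible v \<Delta> C)"

text \<open>
  \<open>LEAST\<close> is unspecified if no suitable number exists; a statement about a value of
  \<open>frobenius_number\<close> is meaningful only when all sufficiently large cardinalities occur.
\<close>

definition frobenius_number :: "'a::{field,finite} itself \<Rightarrow> nat \<Rightarrow> nat" where
  "frobenius_number T r =
     (LEAST N. N > 0 \<and> (\<forall>n>N. divisible_set_exists T (CARD('a) ^ r) n))"

end

theory Submission
  imports Defs
begin

text \<open>
  For a family of \<open>n\<close> points let \<open>w(h)\<close> be the number of points off the hyperplane \<open>h = 0\<close> and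
  \<open>s(h) = n - 2 w(h)\<close>.  As a sum of characters, \<open>s\<close> has mean \<open>0\<close>, mean square \<open>n\<close> and nonnegative
  mean cube over all functionals \<open>h\<close>.  Polynomials of degree 2 and 3 that are nonnegative on the
  values of \<open>s\<close> permitted by divisibility exclude most cardinalities.  The others are excluded since
  some hyperplane contains fewer than half of the points, and the points on a hyperplane form a
  \<open>\<Delta>\<close>-divisible set when the whole set is \<open>2 \<Delta>\<close>-divisible.  Existence follows from finitely many
  examples, because disjoint unions in a direct sum preserve divisibility.
\<close>

section \<open>Divisible families of sets\<close>

text \<open>
  Over the field with two elements a nonzero vector spans exactly one point and is determined by its
  support, so a set of points is a family of nonempty sets of coordinates.  Linear functionals are
  supports \<open>h\<close> as well, with \<open>x\<close> in the kernel iff \<open>card (x \<inter> h)\<close> is even.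
\<close>

definition weight :: "'b set set \<Rightarrow> 'b set \<Rightarrow> nat" where
  "weight S h = card {x \<in> S. odd (card (x \<inter> h))}"

definition divisible_family :: "nat \<Rightarrow> 'b set set \<Rightarrow> bool" where
  "divisible_family \<Delta> S \<longleftrightarrow>
     finite S \<and> (\<forall>x\<in>S. finite x \<and> x \<noteq> {}) \<and> (\<forall>h. finite h \<longrightarrow> \<Delta> dvd weight S h)"

definition family_exists :: "nat \<Rightarrow> nat \<Rightarrow> bool" where
  "family_exists \<Delta> n \<longleftrightarrow> (\<exists>S :: nat set set. divisible_family \<Delta> S \<and> card S = n)"

definition section_of :: "'b set set \<Rightarrow> 'b set \<Rightarrow> 'b set set" where
  "section_of S h = {x \<in> S. even (card (x \<inter> h))}"

text \<open>Vectors over the two-element field add by \<open>sym_diff\<close> of supports; modulo 2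
  this is additivity of the pairing.\<close>

lemma card_sym_diff_Int:
  fixes x h k :: "'b set"
  assumes "finite x"
  shows "card (x \<inter> sym_diff h k) + 2 * card (x \<inter> h \<inter> k) = card (x \<inter> h) + card (x \<inter> k)"
proof -
  have "x \<inter> sym_diff h k = (x \<inter> h - k) \<union> (x \<inter> k - h)" by blast
  then have "card (x \<inter> sym_diff h k) = card (x \<inter> h - k) + card (x \<inter> k - h)"
    using assms by (simp add: card_Un_disjoint disjoint_iff)
  moreover have "card (x \<inter> h) = card (x \<inter> h - k) + card (x \<inter> h \<inter> k)"
    using assms by (metis add.commute card_Int_Diff finite_Int)
  moreover have "card (x \<inter> k) = card (x \<inter> k - h) + card (x \<inter> h \<inter> k)"
    using assms by (metis add.commute card_Int_Diff finite_Int inf_assoc inf_commute)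
  ultimately show ?thesis by simp
qed

lemma odd_card_sym_diff:
  fixes x h k :: "'b set"
  assumes "finite x"
  shows "odd (card (x \<inter> sym_diff h k)) \<longleftrightarrow> odd (card (x \<inter> h)) \<noteq> odd (card (x \<inter> k))"
  using card_sym_diff_Int[OF assms, of h k] by presburger

text \<open>Sort \<open>S\<close> by parities (p, q) against \<open>g\<close> and \<open>h\<close>.
  The section weight counts type (1,0), the other weights two types each; both sides are 2 (1,0) +
  (1,1) + (0,1).\<close>

lemma weight_section:
  fixes S :: "'b set set"
  assumes "finite S" "\<And>x. x \<in> S \<Longrightarrow> finite x"
  shows "2 * weight (section_of S h) g + weight S h = weight S g + weight S (sym_diff g h)"
proof -
  define a where "a p q = card {x \<in> S. odd (card (x \<inter> g)) = p \<and> odd (card (x \<inter> h)) = q}" for p q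
  have split: "card {x \<in> S. P x} = card {x \<in> S. P x \<and> Q x} + card {x \<in> S. P x \<and> \<not> Q x}" for P Q
    using assms(1) by (subst card_Un_disjoint[symmetric]) (auto intro: arg_cong[where f = card])
  have s: "weight (section_of S h) g = a True False"
    unfolding weight_def section_of_def a_def by (intro arg_cong[where f = card]) auto
  have h: "weight S h = a True True + a False True"
    unfolding weight_def a_def by (subst split[where Q = "\<lambda>x. odd (card (x \<inter> g))"]) (simp add: conj_commute)
  have g: "weight S g = a True True + a True False"
    unfolding weight_def a_def by (subst split[where Q = "\<lambda>x. odd (card (x \<inter> h))"]) simp
  have "weight S (sym_diff g h) = card {x \<in> S. odd (card (x \<inter> g)) \<noteq> odd (card (x \<inter> h))}"
    unfolding weight_def using assms(2) odd_card_sym_diff by (metis (mono_tags, lifting))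
  also have "\<dots> = a True False + a False True"
    unfolding a_def by (subst split[where Q = "\<lambda>x. odd (card (x \<inter> g))"])
      (auto intro!: arg_cong2[where f = "(+)"] arg_cong[where f = card])
  finally show ?thesis using s h g by simp
qed

lemma card_section:
  assumes "finite S"
  shows "card (section_of S h) + weight S h = card S"
  unfolding section_of_def weight_def using assms
  by (subst card_Un_disjoint[symmetric]) (auto intro: arg_cong[where f = card])

text \<open>By \<open>weight_section\<close> twice the section's weight is a multiple of
  \<open>2 * \<Delta>\<close>.\<close>

lemma divisible_family_section:
  assumes "divisible_family (2 * \<Delta>) S" "finite h"
  shows "divisible_family \<Delta> (section_of S h)"
proof -
  have "\<Delta> dvd weight (section_of S h) g" if "finite g" for g
  proof -
    have "2 * \<Delta> dvd weight S g + weight S (sym_diff g h)" "2 * \<Delta> dvd weight S h"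
      using assms that by (auto simp: divisible_family_def)
    then have "2 * \<Delta> dvd 2 * weight (section_of S h) g"
      using weight_section[of S h g] assms(1) by (metis dvd_add_left_iff divisible_family_def)
    then show ?thesis by simp
  qed
  then show ?thesis using assms by (auto simp: divisible_family_def section_of_def)
qed

lemma weight_Un:
  assumes "finite S" "finite T" "S \<inter> T = {}"
  shows "weight (S \<union> T) h = weight S h + weight T h"
  unfolding weight_def using assms
  by (subst card_Un_disjoint[symmetric]) (auto intro: arg_cong[where f = card])

lemma weight_image:
  assumes "inj f"
  shows "weight ((`) f ` S) h = weight S (f -` h)"
proof -
  have "card (f ` x \<inter> h) = card (x \<inter> f -` h)" for x
  proof -
    have "f ` x \<inter> h = f ` (x \<inter> f -` h)" by blast
    then show ?thesis using assms by (metis card_image inj_on_subset subset_UNIV)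
  qed
  then have "{y \<in> (`) f ` S. odd (card (y \<inter> h))} = (`) f ` {x \<in> S. odd (card (x \<inter> f -` h))}"
    by auto
  moreover have "inj ((`) f)" using assms by (simp add: inj_image_eq_iff inj_def)
  ultimately show ?thesis
    unfolding weight_def by (metis (no_types, lifting) card_image inj_on_subset subset_UNIV)
qed

lemma divisible_family_image:
  assumes "inj f" "divisible_family \<Delta> S"
  shows "divisible_family \<Delta> ((`) f ` S)"
  using assms by (auto simp: divisible_family_def weight_image finite_vimageI)

text \<open>Direct sum: the families move to even and odd coordinates. Their images share no member
  because supports are nonempty, so weights add.\<close>

lemma family_exists_add:
  assumes "family_exists \<Delta> m" "family_exists \<Delta> n"
  shows "family_exists \<Delta> (m + n)"
proof -
  obtain S T :: "nat set set" where S: "divisible_family \<Delta> S" "card S = m"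
    and T: "divisible_family \<Delta> T" "card T = n"
    using assms by (auto simp: family_exists_def)
  define S' where "S' = (`) (\<lambda>i. 2 * i) ` S"
  define T' where "T' = (`) (\<lambda>i. 2 * i + 1) ` T"
  have inj: "inj (\<lambda>i::nat. 2 * i)" "inj (\<lambda>i::nat. 2 * i + 1)" by (auto simp: inj_def)
  have fam: "divisible_family \<Delta> S'" "divisible_family \<Delta> T'"
    unfolding S'_def T'_def using inj S T by (blast intro: divisible_family_image)+
  have "card S' = m" "card T' = n"
    unfolding S'_def T'_def using S T inj
    by (metis (no_types, lifting) card_image inj_image_eq_iff inj_onI)+
  moreover have "S' \<inter> T' = {}"
  proof -
    have False if xy: "x \<in> S" "y \<in> T" "(\<lambda>i. 2 * i) ` x = (\<lambda>i. 2 * i + 1) ` y" for x y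
    proof -
      obtain i where "i \<in> x" using S xy by (fastforce simp: divisible_family_def)
      then have "2 * i \<in> (\<lambda>i. 2 * i + 1) ` y" using xy by blast
      then obtain j where "2 * i = 2 * j + 1" by blast
      then show False by presburger
    qed
    then show ?thesis unfolding S'_def T'_def by blast
  qed
  ultimately have "divisible_family \<Delta> (S' \<union> T')" "card (S' \<union> T') = m + n"
    using fam by (auto simp: divisible_family_def weight_Un card_Un_disjoint)
  then show ?thesis by (auto simp: family_exists_def)
qed

section \<open>Characters and nonexistence\<close>

definition character :: "'b set \<Rightarrow> 'b set \<Rightarrow> int" where
  "character h x = (-1) ^ card (x \<inter> h)"

definition character_sum :: "'b set set \<Rightarrow> 'b set \<Rightarrow> int" where
  "character_sum S h = (\<Sum>x\<in>S. character h x)"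

lemma character_sum_weight:
  assumes "finite S"
  shows "character_sum S h = int (card S) - 2 * int (weight S h)"
proof -
  have "character h x = 1 - 2 * (if odd (card (x \<inter> h)) then 1 else 0)" for x
    by (simp add: character_def)
  then show ?thesis
    using assms by (simp add: character_sum_def weight_def sum_subtractf flip: sum_distrib_left sum.inter_filter)
qed

lemma character_mult:
  assumes "finite h"
  shows "character h x * character h y = character h (sym_diff x y)"
proof -
  have "card (h \<inter> sym_diff x y) + 2 * card (h \<inter> x \<inter> y) = card (h \<inter> x) + card (h \<inter> y)"
    using card_sym_diff_Int[OF assms] .
  then have "(-1::int) ^ (card (h \<inter> x) + card (h \<inter> y)) = (-1) ^ card (h \<inter> sym_diff x y)"
    by (metis even_add even_mult_iff even_numeral neg_one_even_power neg_one_odd_power)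
  then show ?thesis by (simp add: character_def power_add Int_commute)
qed

text \<open>Orthogonality: for \<open>i \<in> u\<close>, toggling \<open>i\<close> in
  \<open>h\<close> permutes \<open>Pow V\<close> and flips the sign, so the sum is its own
  negative.\<close>

lemma sum_character:
  assumes "finite V" "u \<subseteq> V"
  shows "(\<Sum>h\<in>Pow V. character h u) = (if u = {} then 2 ^ card V else 0)"
proof (cases "u = {}")
  case True
  then show ?thesis using assms by (simp add: character_def card_Pow)
next
  case False
  then obtain i where i: "i \<in> u" by blast
  have "character (sym_diff h {i}) u = - character h u" if "h \<in> Pow V" for h
  proof -
    have "finite u" using assms finite_subset by blast
    then have "odd (card (u \<inter> sym_diff h {i})) \<longleftrightarrow> odd (card (u \<inter> h)) \<noteq> odd (card (u \<inter> {i}))"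
      by (rule odd_card_sym_diff)
    then show ?thesis using i by (auto simp: character_def)
  qed
  moreover have "(\<Sum>h\<in>Pow V. character h u) = (\<Sum>h\<in>Pow V. character (sym_diff h {i}) u)"
  proof (rule sum.reindex_bij_witness[of _ "\<lambda>h. sym_diff h {i}" "\<lambda>h. sym_diff h {i}"])
    show "sym_diff (sym_diff h {i}) {i} = h" for h by blast
    then show "character (sym_diff (sym_diff h {i}) {i}) u = character h u" for h by simp
  qed (use i assms(2) in blast)+
  ultimately have "(\<Sum>h\<in>Pow V. character h u) = - (\<Sum>h\<in>Pow V. character h u)"
    by (simp add: sum_negf)
  then show ?thesis using False by simp
qed

section \<open>Moments of the character sum over all functionals\<close>

context
  fixes S :: "'b set set" and V :: "'b set"
  assumes V: "finite V" and S: "S \<subseteq> Pow V - {{}}"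
begin

private lemma finite_S: "finite S"
  using V S by (meson finite_Diff finite_Pow_iff finite_subset)

lemma sum_character_sum: "(\<Sum>h\<in>Pow V. character_sum S h) = 0"
proof -
  have "(\<Sum>h\<in>Pow V. character_sum S h) = (\<Sum>x\<in>S. \<Sum>h\<in>Pow V. character h x)"
    unfolding character_sum_def by (rule sum.swap)
  also have "\<dots> = 0"
  proof (rule sum.neutral, rule ballI)
    fix x assume "x \<in> S"
    then have "x \<subseteq> V" "x \<noteq> {}" using S by auto
    then show "(\<Sum>h\<in>Pow V. character h x) = 0" by (simp add: sum_character[OF V])
  qed
  finally show ?thesis .
qed

lemma sum_character_sum_square:
  "(\<Sum>h\<in>Pow V. (character_sum S h)\<^sup>2) = int (card S) * 2 ^ card V"
proof -
  have "(\<Sum>h\<in>Pow V. (character_sum S h)\<^sup>2)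
      = (\<Sum>h\<in>Pow V. \<Sum>x\<in>S. \<Sum>y\<in>S. character h x * character h y)"
    by (simp add: character_sum_def power2_eq_square sum_product)
  also have "\<dots> = (\<Sum>x\<in>S. \<Sum>y\<in>S. \<Sum>h\<in>Pow V. character h x * character h y)"
    by (subst sum.swap) (intro sum.cong refl sum.swap)
  also have "\<dots> = (\<Sum>x\<in>S. \<Sum>y\<in>S. if x = y then 2 ^ card V else 0)"
  proof (rule sum.cong[OF refl], rule sum.cong[OF refl])
    fix x y assume "x \<in> S" "y \<in> S"
    then have "sym_diff x y \<subseteq> V" using S by blast
    moreover have "(\<Sum>h\<in>Pow V. character h x * character h y) = (\<Sum>h\<in>Pow V. character h (sym_diff x y))"
      using V finite_subset by (intro sum.cong refl character_mult) auto
    moreover have "sym_diff x y = {} \<longleftrightarrow> x = y" by blast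
    ultimately show "(\<Sum>h\<in>Pow V. character h x * character h y) = (if x = y then 2 ^ card V else 0)"
      using sum_character[OF V, of "sym_diff x y"] by simp
  qed
  finally show ?thesis using finite_S by simp
qed

text \<open>By orthogonality a triple contributes \<open>2 ^ card V\<close> if its vectors add to
  zero, that is, form a line, and 0 otherwise.\<close>

lemma sum_character_sum_cube: "(\<Sum>h\<in>Pow V. (character_sum S h) ^ 3) \<ge> 0"
proof -
  have "(\<Sum>h\<in>Pow V. (character_sum S h) ^ 3)
      = (\<Sum>h\<in>Pow V. \<Sum>x\<in>S. \<Sum>y\<in>S. \<Sum>z\<in>S. character h x * character h y * character h z)"
  proof (rule sum.cong[OF refl])
    fix h
    have "character_sum S h * character_sum S h = (\<Sum>x\<in>S. \<Sum>y\<in>S. character h x * character h y)"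
      by (simp add: character_sum_def sum_product)
    then have "character_sum S h ^ 3
        = (\<Sum>x\<in>S. \<Sum>y\<in>S. character h x * character h y * character_sum S h)"
      by (simp only: power3_eq_cube sum_distrib_right)
    then show "character_sum S h ^ 3
        = (\<Sum>x\<in>S. \<Sum>y\<in>S. \<Sum>z\<in>S. character h x * character h y * character h z)"
      by (simp add: character_sum_def sum_distrib_left)
  qed
  also have "\<dots> = (\<Sum>x\<in>S. \<Sum>y\<in>S. \<Sum>z\<in>S. \<Sum>h\<in>Pow V. character h x * character h y * character h z)"
    by (subst sum.swap)
      (rule sum.cong[OF refl], subst sum.swap, rule sum.cong[OF refl], rule sum.swap)
  also have "\<dots> \<ge> 0"
  proof (rule sum_nonneg, rule sum_nonneg, rule sum_nonneg)
    fix x y z assume "x \<in> S" "y \<in> S" "z \<in> S"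
    then have "sym_diff (sym_diff x y) z \<subseteq> V" using S by blast
    moreover have "(\<Sum>h\<in>Pow V. character h x * character h y * character h z)
        = (\<Sum>h\<in>Pow V. character h (sym_diff (sym_diff x y) z))"
    proof (intro sum.cong refl)
      fix h assume "h \<in> Pow V"
      then have "finite h" using V finite_subset by blast
      then show "character h x * character h y * character h z = character h (sym_diff (sym_diff x y) z)"
        by (simp only: character_mult)
    qed
    ultimately show "(\<Sum>h\<in>Pow V. character h x * character h y * character h z) \<ge> 0"
      using sum_character[OF V, of "sym_diff (sym_diff x y) z"] by simp
  qed
  finally show ?thesis .
qed

lemma sum_character_sum_quadratic:
  "(\<Sum>h\<in>Pow V. (character_sum S h - a) * (character_sum S h - b)) = (int (card S) + a * b) * 2 ^ card V"
proof -
  have "(character_sum S h - a) * (character_sum S h - b)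
      = (character_sum S h)\<^sup>2 - (a + b) * character_sum S h + a * b" for h
    by (simp add: algebra_simps power2_eq_square)
  then show ?thesis
    using V by (simp add: sum.distrib sum_subtractf sum_character_sum sum_character_sum_square card_Pow
        algebra_simps flip: sum_distrib_left)
qed

end

section \<open>Criteria that exclude cardinalities\<close>

lemma divisible_family_subset_Pow:
  assumes "divisible_family \<Delta> S"
  shows "finite (\<Union>S)" "S \<subseteq> Pow (\<Union>S) - {{}}"
  using assms by (auto simp: divisible_family_def)

text \<open>Otherwise every character sum \<open>s\<close> lies between 0 and
  \<open>n = card S\<close>, so \<open>s * (s - n) \<le> 0\<close> throughout; yet the mean of this
  product is \<open>n > 0\<close>.\<close>

lemma ex_small_section:
  assumes "divisible_family \<Delta> S" "S \<noteq> {}"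
  shows "\<exists>h. finite h \<and> 2 * card (section_of S h) < card S"
proof (rule ccontr)
  assume neg: "\<nexists>h. finite h \<and> 2 * card (section_of S h) < card S"
  note V = divisible_family_subset_Pow[OF assms(1)]
  have fin: "finite S" using assms by (simp add: divisible_family_def)
  let ?n = "int (card S)"
  have "(character_sum S h - ?n) * (character_sum S h - 0) \<le> 0" if "h \<in> Pow (\<Union>S)" for h
  proof -
    have "finite h" using that V(1) finite_subset by blast
    then have "card S \<le> 2 * card (section_of S h)" using neg by force
    moreover have "character_sum S h = 2 * int (card (section_of S h)) - ?n"
      "character_sum S h \<le> ?n"
      using card_section[OF fin, of h] character_sum_weight[OF fin, of h] by auto
    ultimately show ?thesis by (intro mult_nonpos_nonneg) auto
  qed
  then have "(\<Sum>h\<in>Pow (\<Union>S). (character_sum S h - ?n) * (character_sum S h - 0)) \<le> 0"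
    by (rule sum_nonpos)
  then have "?n * 2 ^ card (\<Union>S) \<le> 0"
    by (simp only: sum_character_sum_quadratic[OF V]) simp
  moreover have "card S > 0" using assms fin by (simp add: card_gt_0_iff)
  ultimately show False by (simp add: mult_le_0_iff)
qed

text \<open>The small section inherits half the divisor, and \<open>n - m\<close> is a weight of the
  whole family, which fixes \<open>m\<close> modulo \<open>2 * \<Delta>\<close>.\<close>

lemma family_exists_small_section:
  assumes "family_exists (2 * \<Delta>) n" "n > 0"
  shows "\<exists>m. family_exists \<Delta> m \<and> 2 * m < n \<and> 2 * \<Delta> dvd n - m"
proof -
  obtain S :: "nat set set" where S: "divisible_family (2 * \<Delta>) S" "card S = n"
    using assms by (auto simp: family_exists_def)
  then obtain h where h: "finite h" "2 * card (section_of S h) < n"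
    using ex_small_section[OF S(1)] assms(2) by fastforce
  have "n - card (section_of S h) = weight S h"
    using S card_section[of S h] by (auto simp: divisible_family_def)
  then have "2 * \<Delta> dvd n - card (section_of S h)"
    using S(1) h(1) by (simp add: divisible_family_def)
  then show ?thesis
    using h divisible_family_section[OF S(1) h(1)] by (auto simp: family_exists_def)
qed

text \<open>
  With \<open>w = \<Delta> j\<close> and \<open>s = n - 2 w\<close>, the quadratic polynomial
  \<open>(s - (n - 2 \<Delta> k)) (s - (n - 2 \<Delta> (k + 1))) = 4 \<Delta>\<^sup>2 (k - j) (k + 1 - j)\<close> is nonnegative at every
  functional.
\<close>

lemma not_family_exists_gap:
  fixes k n \<Delta> :: nat
  assumes "\<Delta> > 0"
    and gap: "int n + (int n - 2 * int \<Delta> * int k) * (int n - 2 * int \<Delta> * (int k + 1)) < of_bool (k > 0)"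
  shows "\<not> family_exists \<Delta> n"
proof
  assume "family_exists \<Delta> n"
  then obtain S :: "nat set set" where S: "divisible_family \<Delta> S" "card S = n"
    by (auto simp: family_exists_def)
  note V = divisible_family_subset_Pow[OF S(1)]
  have fin: "finite S" using S by (simp add: divisible_family_def)
  define a b where "a = int n - 2 * int \<Delta> * int k" and "b = int n - 2 * int \<Delta> * (int k + 1)"
  let ?p = "\<lambda>h. (character_sum S h - a) * (character_sum S h - b)"
  have nonneg: "?p h \<ge> 0" if "h \<in> Pow (\<Union>S)" for h
  proof -
    have "finite h" using that V(1) finite_subset by blast
    then have "\<Delta> dvd weight S h" using S by (simp add: divisible_family_def)
    then obtain j where j: "weight S h = \<Delta> * j" by blast
    have "?p h = (2 * int \<Delta>)\<^sup>2 * ((int k - int j) * (int k + 1 - int j))"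
      unfolding character_sum_weight[OF fin] a_def b_def S(2) j
      by (simp add: algebra_simps power2_eq_square)
    moreover have "(int k - int j) * (int k + 1 - int j) \<ge> 0"
      by (cases "k \<ge> j") (auto intro: mult_nonneg_nonneg mult_nonpos_nonpos)
    ultimately show ?thesis by simp
  qed
  have eq: "(\<Sum>h\<in>Pow (\<Union>S). ?p h) = (int n + a * b) * 2 ^ card (\<Union>S)"
    using sum_character_sum_quadratic[OF V] S(2) by simp
  \<comment> \<open>The zero functional has character sum \<open>n\<close>, so its term is positive
    when \<open>k > 0\<close>; this makes the mean strictly positive and accounts for
    \<open>of_bool\<close> in \<open>gap\<close>.\<close>
  have "?p {} \<le> (\<Sum>h\<in>Pow (\<Union>S). ?p h)"
    using V nonneg by (intro member_le_sum) auto
  moreover have "?p {} = (2 * int \<Delta>)\<^sup>2 * (int k * (int k + 1))"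
    by (simp add: character_sum_def character_def S(2) a_def b_def power2_eq_square algebra_simps)
  ultimately have le: "(2 * int \<Delta>)\<^sup>2 * (int k * (int k + 1)) \<le> (int n + a * b) * 2 ^ card (\<Union>S)"
    using eq by simp
  show False
  proof (cases "k > 0")
    case True
    then have "(2 * int \<Delta>)\<^sup>2 * (int k * (int k + 1)) > 0" using assms(1) by simp
    with le have "(int n + a * b) * 2 ^ card (\<Union>S) > 0" by linarith
    then have "int n + a * b > 0" by (simp add: zero_less_mult_iff)
    then show False using gap True by (simp add: a_def b_def)
  next
    case False
    then have "int n + a * b \<ge> 0" using le by (simp add: zero_le_mult_iff)
    then show False using gap False by (simp add: a_def b_def)
  qed
qed

text \<open>
  The quadratic bound just fails for 52; the cubic \<open>w (w - 24) (w - 32)\<close>, which is nonnegative at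
  every multiple \<open>w \<ge> 0\<close> of 8, has negative mean.
\<close>

lemma not_family_exists_52: "\<not> family_exists 8 52"
proof
  assume "family_exists 8 52"
  then obtain S :: "nat set set" where S: "divisible_family 8 S" "card S = 52"
    by (auto simp: family_exists_def)
  note V = divisible_family_subset_Pow[OF S(1)]
  have fin: "finite S" using S by (simp add: divisible_family_def)
  let ?s = "character_sum S"
  \<comment> \<open>With \<open>s = 52 - 2 * w\<close>, the roots 52, 4 and -12 are the weights 0,
    24 and 32.\<close>
  have "(52 - ?s h) * ((?s h - 4) * (?s h + 12)) \<ge> 0" if "h \<in> Pow (\<Union>S)" for h
  proof -
    have "finite h" using that V(1) finite_subset by blast
    then have "8 dvd weight S h" using S by (simp add: divisible_family_def)
    then obtain j where j: "weight S h = 8 * j" by blast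
    have "(?s h - 4) * (?s h + 12) = 256 * ((int j - 3) * (int j - 4))" "52 - ?s h = 16 * int j"
      unfolding character_sum_weight[OF fin] S(2) j by (simp_all add: algebra_simps)
    moreover have "(int j - 3) * (int j - 4) \<ge> 0"
      by (cases "j \<ge> 4") (auto intro: mult_nonneg_nonneg mult_nonpos_nonpos)
    ultimately show ?thesis by simp
  qed
  then have "0 \<le> (\<Sum>h\<in>Pow (\<Union>S). (52 - ?s h) * ((?s h - 4) * (?s h + 12)))"
    by (rule sum_nonneg)
  also have "\<dots> = (\<Sum>h\<in>Pow (\<Union>S). 44 * (?s h)\<^sup>2 - ?s h ^ 3 + 464 * ?s h - 2496)"
    by (intro sum.cong refl) (simp add: algebra_simps power2_eq_square power3_eq_cube)
  also have "\<dots> = 44 * (52 * 2 ^ card (\<Union>S)) - (\<Sum>h\<in>Pow (\<Union>S). ?s h ^ 3) - 2496 * 2 ^ card (\<Union>S)"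
    using V(1) by (simp add: sum.distrib sum_subtractf sum_character_sum[OF V] card_Pow S(2)
        sum_character_sum_square[OF V] flip: sum_distrib_left)
  \<comment> \<open>\<open>44 * 52 - 2496 = -208\<close>, and the nonnegative cube sum is
    subtracted.\<close>
  also have "\<dots> < 0"
  proof -
    have "(2::int) ^ card (\<Union>S) > 0" by simp
    then show ?thesis using sum_character_sum_cube[OF V] by linarith
  qed
  finally show False by simp
qed

section \<open>Examples\<close>

text \<open>
  If a \<open>2^r\<close>-divisible set contains the nonzero vectors \<open>W\<close> of an \<open>r\<close>-dimensional subspace, it stays
  divisible when \<open>W\<close> is replaced by the coset \<open>a + (W \<union> {0})\<close> for a new direction \<open>a\<close>; the
  cardinality grows by one.  Here the first \<open>k\<close> members of a family of disjoint such sets are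
  switched, \<open>d\<close> being a power of two above all entries, so that \<open>d * i\<close> are distinct directions.
\<close>

definition switched :: "int \<Rightarrow> nat \<Rightarrow> int list list \<Rightarrow> int list" where
  "switched d k Ws = concat (drop k Ws) @
     concat (map (\<lambda>(i, W). map (\<lambda>w. w + d * i) (0 # W)) (zip [1..int k] (take k Ws)))"

text \<open>
  Vectors are given by their binary expansion.  The recursion uses
  \<open>w(h + e) = w(h) + w(e) - 2 w'(h)\<close>, where \<open>w'\<close> is the weight of the vectors that are nonzero
  in coordinate \<open>e\<close>.
\<close>

fun weights_divisible :: "nat \<Rightarrow> nat \<Rightarrow> int list \<Rightarrow> bool" where
  "weights_divisible 0 v ns \<longleftrightarrow> True"
| "weights_divisible (Suc r) 0 ns \<longleftrightarrow> True"
| "weights_divisible (Suc r) (Suc v) ns \<longleftrightarrow>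
     (let ms = filter (\<lambda>n. bit n v) ns
      in 2 ^ Suc r dvd length ms \<and> weights_divisible r v ms \<and> weights_divisible (Suc r) v ns)"

text \<open>Unfolded, the test asks for each set of \<open>j\<close> coordinates, 1 \<le> j \<le> r,
  that \<open>2 ^ (r - j + 1)\<close> divide the number of vectors with ones in all of them. The
  factor 2 before \<open>w'\<close> lets each filtering lower the exponent by one.\<close>

lemma weights_divisible_dvd:
  assumes "weights_divisible r v ns" "h \<subseteq> {..<v}"
  shows "2 ^ r dvd length (filter (\<lambda>n. odd (card ({i. bit n i} \<inter> h))) ns)"
  using assms
proof (induction r v ns arbitrary: h rule: weights_divisible.induct)
  case (3 r v ns)
  let ?c = "\<lambda>ns h. length (filter (\<lambda>n::int. odd (card ({i. bit n i} \<inter> h))) ns)"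
  define ms where "ms = filter (\<lambda>n. bit n v) ns"
  define g where "g = h - {v}"
  have g: "g \<subseteq> {..<v}" using "3.prems" by (auto simp: g_def lessThan_Suc)
  have ch: "2 ^ Suc r dvd length ms" "weights_divisible r v ms" "weights_divisible (Suc r) v ns"
    using "3.prems" by (auto simp: ms_def Let_def)
  have IH: "2 ^ r dvd ?c ms g" "2 ^ Suc r dvd ?c ns g"
    using "3.IH"(1)[OF ms_def _ g] "3.IH"(2)[OF ms_def _ g] ch by auto
  show ?case
  proof (cases "v \<in> h")
    case False
    then show ?thesis using IH g_def by simp
  next
    case True
    have "finite g" using g finite_subset by blast
    with True have h: "h = insert v g" "v \<notin> g" "finite g" by (auto simp: g_def)
    have "odd (card ({i. bit n i} \<inter> h)) \<longleftrightarrow> bit n v \<noteq> odd (card ({i. bit n i} \<inter> g))" for n :: int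
      using h by (simp add: Int_insert_right)
    then have "?c ns h + 2 * ?c ms g = ?c ns g + length ms"
      unfolding ms_def by (induction ns) auto
    moreover have "2 ^ Suc r dvd 2 * ?c ms g" using IH by simp
    ultimately show ?thesis using IH ch by (metis dvd_add dvd_add_left_iff)
  qed
qed auto

definition certifies :: "nat \<Rightarrow> nat \<Rightarrow> int list \<Rightarrow> nat \<Rightarrow> bool" where
  "certifies r v ns n \<longleftrightarrow>
     weights_divisible r v ns \<and> distinct ns \<and> list_all (\<lambda>x. 0 < x \<and> x < 2 ^ v) ns \<and> length ns = n"

text \<open>An integer stands for its set of bit positions. Entries lie below \<open>2 ^ v\<close>,
  so only \<open>h \<inter> {..<v}\<close> matters, where \<open>weights_divisible_dvd\<close>
  applies.\<close>

lemma family_exists_certified: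
  assumes "certifies r v ns n"
  shows "family_exists (2 ^ r) n"
proof -
  note cert = assms[unfolded certifies_def]
  let ?b = "\<lambda>n::int. {i. bit n i}"
  have inj: "inj ?b" by (auto simp: inj_def bit_eq_iff)
  have sub: "?b n \<subseteq> {..<v}" if "n \<in> set ns" for n
  proof
    fix i assume "i \<in> ?b n"
    moreover have "0 < n" "n < 2 ^ v" using cert that by (auto simp: list_all_iff)
    ultimately show "i \<in> {..<v}"
      by (metis bit_take_bit_iff less_imp_le lessThan_iff mem_Collect_eq take_bit_int_eq_self)
  qed
  have "weight (?b ` set ns) h = length (filter (\<lambda>n. odd (card (?b n \<inter> h))) ns)" for h
  proof -
    have "{x \<in> ?b ` set ns. odd (card (x \<inter> h))} = ?b ` {n \<in> set ns. odd (card (?b n \<inter> h))}" by auto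
    then have "weight (?b ` set ns) h = card {n \<in> set ns. odd (card (?b n \<inter> h))}"
      unfolding weight_def using inj by (metis (no_types, lifting) card_image inj_on_subset subset_UNIV)
    then show ?thesis using cert by (simp add: distinct_length_filter Int_def conj_commute)
  qed
  moreover have "filter (\<lambda>n. odd (card (?b n \<inter> h))) ns = filter (\<lambda>n. odd (card (?b n \<inter> (h \<inter> {..<v})))) ns" for h
  proof (rule filter_cong[OF refl])
    fix n assume "n \<in> set ns"
    then have "?b n \<inter> h = ?b n \<inter> (h \<inter> {..<v})" using sub by blast
    then show "odd (card (?b n \<inter> h)) = odd (card (?b n \<inter> (h \<inter> {..<v})))" by simp
  qed
  moreover have "finite (?b n) \<and> ?b n \<noteq> {}" if "n \<in> set ns" for n
  proof
    show "finite (?b n)" using sub[OF that] finite_subset by blast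
    have "n \<noteq> 0" using cert that by (auto simp: list_all_iff)
    then show "?b n \<noteq> {}" by (auto simp: bit_eq_iff)
  qed
  moreover have "2 ^ r dvd weight (?b ` set ns) h" for h
    unfolding calculation(1) by (subst calculation(2)) (rule weights_divisible_dvd, use cert in auto)
  ultimately have "divisible_family (2 ^ r) (?b ` set ns)"
    by (simp add: divisible_family_def)
  moreover have "card (?b ` set ns) = n"
    using cert inj by (simp add: card_image distinct_card inj_on_def)
  ultimately show ?thesis unfolding family_exists_def by blast
qed

text \<open>
  The two spreads consist of the cosets of the multiplicative groups of \<open>GF(4)\<close> in \<open>GF(16)\<close> and of
  \<open>GF(8)\<close> in \<open>GF(64)\<close>.
\<close>

definition line_spread :: "int list list" where
  "line_spread = [[1, 6, 7], [2, 12, 14], [4, 11, 15], [5, 8, 13], [3, 9, 10]]"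

definition plane_spread :: "int list list" where
  "plane_spread =
    [[1, 14, 15, 22, 23, 24, 25],
     [2, 28, 30, 44, 46, 48, 50],
     [4, 27, 31, 35, 39, 56, 60],
     [5, 8, 13, 51, 54, 59, 62],
     [10, 16, 26, 37, 47, 53, 63],
     [9, 20, 29, 32, 41, 52, 61],
     [3, 17, 18, 40, 43, 57, 58],
     [6, 19, 21, 34, 36, 49, 55],
     [7, 11, 12, 33, 38, 42, 45]]"

text \<open>The next four sets were found by computer search with prescribed automorphisms.\<close>

definition set49 :: "int list" where
  "set49 =
   [11, 13, 17, 19, 21, 26, 28, 39, 48, 50, 52, 56, 62, 64, 67, 77, 90, 92, 95, 97, 98, 108, 115,
    117, 126, 128, 137, 143, 151, 152, 158, 161, 171, 173, 178, 180, 182, 197, 198, 201, 203, 207,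
    217, 224, 228, 230, 231, 234, 248]"

definition set50 :: "int list" where
  "set50 =
   [6, 9, 12, 16, 24, 26, 32, 53, 58, 62, 67, 74, 78, 80, 88, 92, 93, 95, 103, 108, 111, 112, 114,
    117, 120, 122, 128, 141, 142, 146, 162, 164, 166, 177, 194, 198, 199, 200, 204, 212, 217, 219,
    227, 228, 230, 235, 238, 240, 241, 244]"

definition set51 :: "int list" where
  "set51 =
   [1, 2, 22, 24, 28, 47, 49, 54, 58, 60, 63, 65, 70, 72, 76, 77, 83, 86, 89, 92, 95, 100, 107,
    109, 116, 120, 127, 130, 132, 134, 137, 138, 141, 142, 151, 153, 159, 162, 167, 170, 172, 175,
    189, 205, 220, 229, 232, 236, 247, 248, 255]"

text \<open>The first member consists of the seven points of a plane and can be switched, giving 74 points.\<close>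

definition set73 :: "int list list" where
  "set73 =
   [[9, 84, 93, 134, 143, 210, 219],
    [25, 28, 71, 73, 74, 95, 99, 106, 109, 122, 129, 146, 147, 153, 168, 170, 174, 176, 192, 193,
    216, 222, 225, 237, 244, 250, 257, 266, 268, 269, 284, 285, 295, 296, 308, 316, 323, 325, 327,
    328, 333, 337, 352, 355, 363, 369, 393, 397, 398, 400, 402, 415, 418, 433, 437, 445, 469, 476,
    482, 487, 488, 490, 491, 493, 499, 503]]"

text \<open>A line, an affine plane, and a frame: four unit vectors with their sum.\<close>

lemma family_exists_2_small: "family_exists 2 3" "family_exists 2 4" "family_exists 2 5"
proof -
  have "certifies 1 2 [1, 2, 3] 3" "certifies 1 3 [4, 5, 6, 7] 4" "certifies 1 4 [1, 2, 4, 8, 15] 5"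
    by code_simp+
  then show "family_exists 2 3" "family_exists 2 4" "family_exists 2 5"
    by (auto dest: family_exists_certified)
qed

text \<open>The nonzero vectors of a 3-dimensional space and an affine 3-space off the origin;
  \<open>family_exists_8_small\<close> takes the same pair one dimension higher.\<close>

lemma family_exists_4_small: "family_exists 4 7" "family_exists 4 8"
proof -
  have "certifies 2 3 [1..7] 7" "certifies 2 4 [8..15] 8"
    by code_simp+
  then show "family_exists 4 7" "family_exists 4 8"
    by (auto dest: family_exists_certified)
qed

lemma family_exists_8_small: "family_exists 8 15" "family_exists 8 16"
proof -
  have "certifies 3 4 [1..15] 15" "certifies 3 5 [16..31] 16"
    by code_simp+
  then show "family_exists 8 15" "family_exists 8 16"
    by (auto dest: family_exists_certified)
qed

lemma family_exists_4_switched: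
  assumes "k \<in> {2..<6}"
  shows "family_exists 4 (15 + k)"
proof -
  \<comment> \<open>Four bits for the spread and three for up to five directions give
    \<open>v = 7\<close>; each switched line adds one point to the 15.\<close>
  have "list_all (\<lambda>k. certifies 2 7 (switched 16 k line_spread) (15 + k)) [2..<6]"
    by code_simp
  then have "certifies 2 7 (switched 16 k line_spread) (15 + k)"
    using assms by (simp only: list_all_iff set_upt)
  then show ?thesis
    using family_exists_certified[of 2] by simp
qed

lemma family_exists_8_switched:
  assumes "k \<in> {5..<10}"
  shows "family_exists 8 (63 + k)"
proof -
  have "list_all (\<lambda>k. certifies 3 10 (switched 64 k plane_spread) (63 + k)) [5..<10]"
    by code_simp
  then have "certifies 3 10 (switched 64 k plane_spread) (63 + k)"
    using assms by (simp only: list_all_iff set_upt)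
  then show ?thesis
    using family_exists_certified[of 3] by simp
qed

lemma family_exists_8_sporadic:
  "family_exists 8 49" "family_exists 8 50" "family_exists 8 51"
  "family_exists 8 73" "family_exists 8 74"
proof -
  have "certifies 3 8 set49 49" "certifies 3 8 set50 50" "certifies 3 8 set51 51"
    by code_simp+
  moreover have "certifies 3 9 (switched 512 0 set73) 73" "certifies 3 10 (switched 512 1 set73) 74"
    by code_simp+
  ultimately show "family_exists 8 49" "family_exists 8 50" "family_exists 8 51"
    "family_exists 8 73" "family_exists 8 74"
    by (auto dest: family_exists_certified)
qed

section \<open>Points and hyperplanes over the field with two elements\<close>

lemma CARD_2_cases:
  assumes "CARD('a::{field,finite}) = 2"
  shows "(x::'a) = 0 \<or> x = 1"
proof -
  have "UNIV = {0, 1::'a}"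
    using assms by (intro card_subset_eq[symmetric]) auto
  then show ?thesis by blast
qed

lemma CARD_2_add_self:
  assumes "CARD('a::{field,finite}) = 2"
  shows "(x::'a) + x = 0"
proof -
  have "(1::'a) + 1 = 0"
    using CARD_2_cases[OF assms, of "1 + 1"] by (metis add_cancel_right_right one_neq_zero)
  then have "x * (1 + 1) = 0" by simp
  then show ?thesis by (simp only: distrib_left mult_1_right)
qed

text \<open>Adjoining an independent \<open>a\<close> doubles the span: it becomes the disjoint
  union of the old span and its translate by \<open>a\<close>.\<close>

lemma card_span_independent:
  fixes B :: "(nat \<Rightarrow> 'a::{field,finite}) set"
  assumes "finite B" "seq.independent B" "CARD('a) = 2"
  shows "card (seq.span B) = 2 ^ card B \<and> finite (seq.span B)"
  using assms(1,2)
proof (induction B rule: finite_induct)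
  case empty
  then show ?case by simp
next
  case (insert a B)
  then have ind: "seq.independent B" "a \<notin> seq.span B"
    by (auto simp: seq.independent_insert)
  have IH: "card (seq.span B) = 2 ^ card B" "finite (seq.span B)"
    using insert.IH ind by auto
  have scale: "seq_scale 0 a = 0" "seq_scale 1 a = a" by simp_all
  have "seq.span (insert a B) = seq.span B \<union> (+) a ` seq.span B"
  proof (intro subset_antisym subsetI)
    fix x assume "x \<in> seq.span (insert a B)"
    then obtain k where k: "x - seq_scale k a \<in> seq.span B" by (auto simp: seq.span_insert)
    show "x \<in> seq.span B \<union> (+) a ` seq.span B"
    proof (cases "k = 0")
      case False
      then have "k = 1" using CARD_2_cases[OF assms(3)] by blast
      then have "x - a \<in> seq.span B" using k by simp
      then have "a + (x - a) \<in> (+) a ` seq.span B" by blast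
      then show ?thesis by simp
    qed (use k in simp)
  next
    fix x assume "x \<in> seq.span B \<union> (+) a ` seq.span B"
    then show "x \<in> seq.span (insert a B)"
    proof
      assume "x \<in> (+) a ` seq.span B"
      then obtain y where "y \<in> seq.span B" "x = a + y" by blast
      then show ?thesis
        by (metis insertI1 seq.span_add seq.span_base seq.span_mono subsetD subset_insertI)
    qed (meson seq.span_mono subsetD subset_insertI)
  qed
  moreover have "seq.span B \<inter> (+) a ` seq.span B = {}"
  proof -
    have "a \<in> seq.span B" if "a + y \<in> seq.span B" "y \<in> seq.span B" for y
      using seq.span_diff[OF that] by simp
    then show ?thesis using ind by blast
  qed
  ultimately show ?case
    using IH insert by (simp add: card_Un_disjoint card_image)
qed

lemma card_subspace:
  fixes U :: "(nat \<Rightarrow> 'a::{field,finite}) set"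
  assumes "seq.subspace U" "finite U" "CARD('a) = 2"
  shows "card U = 2 ^ seq.dim U"
proof -
  obtain B where B: "B \<subseteq> U" "seq.independent B" "U \<subseteq> seq.span B" "card B = seq.dim U"
    using seq.basis_exists by blast
  then have "seq.span B = U"
    using assms(1) by (meson seq.span_minimal subset_antisym)
  moreover have "finite B" using B assms finite_subset by blast
  ultimately show ?thesis using card_span_independent[OF _ B(2) assms(3)] B(4) by simp
qed

section \<open>Points and hyperplanes in terms of supports\<close>

definition vec :: "nat set \<Rightarrow> nat \<Rightarrow> 'a::field" where
  "vec A = (\<lambda>i. if i \<in> A then 1 else 0)"

lemma vec_eq_iff [simp]: "vec A = (vec B :: nat \<Rightarrow> 'a::field) \<longleftrightarrow> A = B"
  by (auto simp: vec_def fun_eq_iff split: if_splits)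

lemma vec_empty [simp]: "vec {} = 0"
  by (simp add: vec_def fun_eq_iff)

lemma vec_eq_0_iff [simp]: "vec A = (0 :: nat \<Rightarrow> 'a::field) \<longleftrightarrow> A = {}"
  by (metis vec_empty vec_eq_iff)

lemma vec_add:
  assumes "CARD('a::{field,finite}) = 2"
  shows "vec A + vec B = (vec (sym_diff A B) :: nat \<Rightarrow> 'a)"
  using CARD_2_add_self[OF assms, of 1] by (auto simp: vec_def fun_eq_iff)

lemma tuple_space_eq:
  assumes "CARD('a::{field,finite}) = 2"
  shows "(tuple_space v :: (nat \<Rightarrow> 'a) set) = vec ` Pow {..<v}"
proof (intro subset_antisym subsetI)
  fix x :: "nat \<Rightarrow> 'a" assume x: "x \<in> tuple_space v"
  then have "{i. x i \<noteq> 0} \<in> Pow {..<v}" by (auto simp: tuple_space_def not_le[symmetric])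
  moreover have "x = vec {i. x i \<noteq> 0}"
    using CARD_2_cases[OF assms] by (fastforce simp: vec_def fun_eq_iff)
  ultimately show "x \<in> vec ` Pow {..<v}" by blast
qed (auto simp: tuple_space_def vec_def)

lemma subspace_char_2:
  fixes U :: "(nat \<Rightarrow> 'a::{field,finite}) set"
  assumes "CARD('a) = 2" "0 \<in> U" "\<And>x y. x \<in> U \<Longrightarrow> y \<in> U \<Longrightarrow> x + y \<in> U"
  shows "seq.subspace U"
proof (rule seq.subspaceI)
  fix c :: 'a and x assume "x \<in> U"
  then show "seq_scale c x \<in> U"
    using CARD_2_cases[OF assms(1), of c] assms(2) by auto
qed (use assms in auto)

lemma points_eq:
  assumes "CARD('a::{field,finite}) = 2"
  shows "(points v :: (nat \<Rightarrow> 'a) set set) = (\<lambda>A. {0, vec A}) ` (Pow {..<v} - {{}})"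
proof (intro subset_antisym subsetI)
  fix P :: "(nat \<Rightarrow> 'a) set" assume "P \<in> points v"
  then have P: "P \<subseteq> vec ` Pow {..<v}" "seq.subspace P" "seq.dim P = 1"
    by (auto simp: points_def subspaces_of_dim_def tuple_space_eq[OF assms])
  have "finite P" using P(1) finite_subset by blast
  then have "card P = 2" using card_subspace[OF P(2) _ assms] P(3) by simp
  moreover have "0 \<in> P" using P(2) by (rule seq.subspace_0)
  ultimately obtain x where x: "P = {0, x}" "x \<noteq> 0"
    by (metis card_2_iff doubleton_eq_iff insertE singletonD)
  then obtain A where "A \<in> Pow {..<v}" "x = vec A" using P(1) by blast
  then show "P \<in> (\<lambda>A. {0, vec A}) ` (Pow {..<v} - {{}})" using x by auto
next
  fix P :: "(nat \<Rightarrow> 'a) set" assume "P \<in> (\<lambda>A. {0, vec A}) ` (Pow {..<v} - {{}})"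
  then obtain A where A: "A \<subseteq> {..<v}" "A \<noteq> {}" "P = {0, vec A}" by auto
  have "vec A + vec A = (0 :: nat \<Rightarrow> 'a)" by (simp add: vec_add[OF assms])
  then have sub: "seq.subspace P"
    unfolding A(3) by (intro subspace_char_2[OF assms]) auto
  have "card P = 2" using A by simp
  moreover have "finite P" using A by simp
  ultimately have "(2::nat) ^ seq.dim P = 2 ^ 1" using card_subspace[OF sub _ assms] by simp
  then have "seq.dim P = 1" by (metis one_less_numeral_iff power_inject_exp semiring_norm(76))
  moreover have "0 \<in> (vec ` Pow {..<v} :: (nat \<Rightarrow> 'a) set)" by (metis Pow_bottom imageI vec_empty)
  ultimately show "P \<in> points v"
    using sub A by (auto simp: points_def subspaces_of_dim_def tuple_space_eq[OF assms])
qed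

lemma sym_diff_mem_iff:
  assumes "CARD('a::{field,finite}) = 2" "seq.subspace U" "(vec B :: nat \<Rightarrow> 'a) \<in> U"
  shows "vec (sym_diff A B) \<in> U \<longleftrightarrow> (vec A :: nat \<Rightarrow> 'a) \<in> U"
proof
  assume "vec (sym_diff A B) \<in> U"
  then have "vec (sym_diff (sym_diff A B) B) \<in> U"
    using seq.subspace_add[OF assms(2) _ assms(3)] vec_add[OF assms(1)] by metis
  moreover have "sym_diff (sym_diff A B) B = A" by blast
  ultimately show "vec A \<in> U" by simp
next
  assume "vec A \<in> U"
  then show "vec (sym_diff A B) \<in> U"
    using seq.subspace_add[OF assms(2) _ assms(3)] vec_add[OF assms(1)] by metis
qed

text \<open>A hyperplane has index 2, so two vectors outside it add up to one inside. Membership of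
  \<open>vec A\<close> is therefore the parity of the number of unit vectors of \<open>A\<close>
  outside \<open>U\<close>; \<open>h\<close> collects their coordinates.\<close>

lemma hyperplane_functional:
  assumes "CARD('a::{field,finite}) = 2" "v \<ge> 1" "U \<in> hyperplanes v"
  obtains h where "h \<subseteq> {..<v}"
    "\<And>A. A \<subseteq> {..<v} \<Longrightarrow> (vec A :: nat \<Rightarrow> 'a) \<in> U \<longleftrightarrow> even (card (A \<inter> h))"
proof -
  have U: "U \<subseteq> vec ` Pow {..<v}" "seq.subspace U" "seq.dim U = v - 1"
    using assms(3) by (auto simp: hyperplanes_def subspaces_of_dim_def tuple_space_eq[OF assms(1)])
  have finU: "finite U" using U(1) finite_subset by blast
  have cardU: "card U = 2 ^ (v - 1)" using card_subspace[OF U(2) finU assms(1)] U(3) by simp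
  have add: "vec (sym_diff A B) \<in> U" if AB: "A \<subseteq> {..<v}" "B \<subseteq> {..<v}" "vec A \<notin> U" "vec B \<notin> U" for A B
  proof (rule ccontr)
    assume neg: "vec (sym_diff A B) \<notin> U"
    let ?W = "vec ` Pow {..<v} :: (nat \<Rightarrow> 'a) set"
    \<comment> \<open>Under \<open>neg\<close>, the set \<open>U\<close>, its translate by
      \<open>vec A\<close> and the vector \<open>vec B\<close> are disjoint, too many for a space of
      size \<open>2 * card U\<close>.\<close>
    have U': "(+) (vec A) ` U \<subseteq> ?W - U - {vec B}"
    proof
      fix x assume "x \<in> (+) (vec A) ` U"
      then obtain C where C: "C \<subseteq> {..<v}" "vec C \<in> U" "x = vec A + vec C" using U(1) by auto
      then have x: "x = vec (sym_diff A C)" by (simp add: vec_add[OF assms(1)])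
      have "x \<notin> U" unfolding x using sym_diff_mem_iff[OF assms(1) U(2) C(2)] AB by simp
      moreover have "sym_diff A C \<subseteq> {..<v}" using AB C by blast
      moreover have "x \<noteq> vec B"
      proof
        assume "x = vec B"
        then have "B = sym_diff A C" using x by simp
        then have "sym_diff A B = C" by blast
        then show False using neg C by simp
      qed
      ultimately show "x \<in> ?W - U - {vec B}" using x by auto
    qed
    have "card U = card ((+) (vec A) ` U)" by (simp add: card_image)
    also have "\<dots> \<le> card (?W - U - {vec B})" using U' by (intro card_mono) auto
    also have "\<dots> < card (?W - U)" using AB by (intro psubset_card_mono) auto
    also have "\<dots> = card ?W - card U" using U(1) finU by (simp add: card_Diff_subset)
    also have "card ?W = 2 ^ v" by (simp add: card_image inj_on_def card_Pow)
    finally have "2 * card U < 2 ^ v" by simp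
    \<comment> \<open>For \<open>v = 0\<close> truncated subtraction would make this false.\<close>
    moreover have "2 * card U = 2 ^ v" using cardU assms(2) by (simp flip: power_Suc)
    ultimately show False by simp
  qed
  define h where "h = {i \<in> {..<v}. (vec {i} :: nat \<Rightarrow> 'a) \<notin> U}"
  have "(vec A :: nat \<Rightarrow> 'a) \<in> U \<longleftrightarrow> even (card (A \<inter> h))" if "A \<subseteq> {..<v}" for A
  proof -
    have "finite A" using that finite_subset by blast
    then show ?thesis using that
    proof (induction A rule: finite_induct)
      case empty
      then show ?case using seq.subspace_0[OF U(2)] by (metis Int_empty_left card.empty even_zero vec_empty)
    next
      case (insert i A)
      have eq: "insert i A = sym_diff A {i}" using insert by blast
      have "(vec (insert i A) :: nat \<Rightarrow> 'a) \<in> U \<longleftrightarrow> (vec A \<in> U \<longleftrightarrow> vec {i} \<in> U)"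
      proof (cases "vec {i} \<in> U")
        case True
        then show ?thesis unfolding eq using sym_diff_mem_iff[OF assms(1) U(2) True] by simp
      next
        case False
        have "vec (sym_diff {i} A) \<in> U \<longleftrightarrow> vec {i} \<in> U" if "vec A \<in> U"
          using sym_diff_mem_iff[OF assms(1) U(2) that] .
        moreover have "sym_diff {i} A = sym_diff A {i}" by blast
        ultimately show ?thesis unfolding eq using add[of A "{i}"] insert.prems False by auto
      qed
      moreover have "i \<in> h \<longleftrightarrow> vec {i} \<notin> U" using insert.prems by (simp add: h_def)
      ultimately show ?case using insert by (cases "i \<in> h") (auto simp: Int_insert_left)
    qed
  qed
  then show thesis using that[of h] by (auto simp: h_def)
qed

text \<open>Toggling some \<open>i \<in> h\<close> exchanges even and odd sets, so the kernel is
  half of the space; its size yields its dimension.\<close>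

lemma functional_hyperplane:
  assumes "CARD('a::{field,finite}) = 2" "h \<subseteq> {..<v}" "h \<noteq> {}"
  shows "(vec ` {A \<in> Pow {..<v}. even (card (A \<inter> h))} :: (nat \<Rightarrow> 'a) set) \<in> hyperplanes v"
proof -
  let ?E = "{A \<in> Pow {..<v}. even (card (A \<inter> h))}" and ?O = "{A \<in> Pow {..<v}. odd (card (A \<inter> h))}"
  let ?U = "vec ` ?E :: (nat \<Rightarrow> 'a) set"
  have fin: "finite h" using assms finite_subset by blast
  have parity: "even (card (sym_diff A B \<inter> h)) \<longleftrightarrow> (even (card (A \<inter> h)) \<longleftrightarrow> even (card (B \<inter> h)))" for A B
    using odd_card_sym_diff[OF fin, of A B] by (metis Int_commute)
  have sub: "seq.subspace ?U"
  proof (rule subspace_char_2[OF assms(1)])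
    show "0 \<in> ?U" by (rule image_eqI[of _ _ "{}"]) auto
    fix x y assume "x \<in> ?U" "y \<in> ?U"
    then obtain A B where "A \<in> ?E" "B \<in> ?E" "x = vec A" "y = vec B" by blast
    then show "x + y \<in> ?U"
      by (intro image_eqI[of _ _ "sym_diff A B"]) (auto simp: vec_add[OF assms(1)] parity)
  qed
  obtain i where i: "i \<in> h" using assms by blast
  have "card ?E = card ?O"
  proof (rule bij_betw_same_card[OF bij_betw_byWitness[where f' = "\<lambda>A. sym_diff A {i}"]])
    show "(\<lambda>A. sym_diff A {i}) ` ?E \<subseteq> ?O" "(\<lambda>A. sym_diff A {i}) ` ?O \<subseteq> ?E"
      using i assms(2) by (auto simp: parity)
  qed blast+
  moreover have "card ?E + card ?O = 2 ^ v"
  proof -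
    have "?E \<union> ?O = Pow {..<v}" "?E \<inter> ?O = {}" by auto
    then show ?thesis by (metis (no_types, lifting) card_Pow card_Un_disjoint card_lessThan finite_Pow_iff finite_Un finite_lessThan)
  qed
  moreover have "card ?U = card ?E" by (simp add: card_image inj_on_def)
  moreover have "v \<ge> 1" using i assms(2) by auto
  ultimately have "2 * card ?U = 2 * 2 ^ (v - 1)" by (simp flip: power_Suc)
  then have "(2::nat) ^ seq.dim ?U = 2 ^ (v - 1)" using card_subspace[OF sub _ assms(1)] by simp
  then have "seq.dim ?U = v - 1" by simp
  then show ?thesis
    using sub by (auto simp: hyperplanes_def subspaces_of_dim_def tuple_space_eq[OF assms(1)])
qed

lemma card_points_hyperplane:
  fixes U :: "(nat \<Rightarrow> 'a::field) set"
  assumes "finite S" "S \<subseteq> Pow {..<v}" "0 \<in> U"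
    and "\<And>A. A \<subseteq> {..<v} \<Longrightarrow> vec A \<in> U \<longleftrightarrow> even (card (A \<inter> h))"
  shows "card {P \<in> (\<lambda>A. {0, vec A}) ` S. P \<subseteq> U} = card (section_of S h)"
proof -
  have "{P \<in> (\<lambda>A. {0, vec A}) ` S. P \<subseteq> U} = (\<lambda>A. {0, vec A}) ` section_of S h"
    using assms by (auto simp: section_of_def)
  moreover have "inj_on (\<lambda>A. {0, vec A :: nat \<Rightarrow> 'a}) (section_of S h)"
    by (auto simp: inj_on_def doubleton_eq_iff)
  ultimately show ?thesis by (simp add: card_image)
qed

lemma cong_section_iff:
  assumes "finite S"
  shows "[card (section_of S h) = card S] (mod \<Delta>) \<longleftrightarrow> \<Delta> dvd weight S h"
proof -
  have "card S = card (section_of S h) + weight S h" using card_section[OF assms] by simp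
  then show ?thesis
    by (simp add: cong_sym_eq[of "card (section_of S h)"] cong_add_lcancel_0_nat cong_0_iff)
qed

text \<open>Bridge to the geometry: a support \<open>A\<close> becomes the point
  \<open>{0, vec A}\<close>, and hyperplanes become functionals, whose weights count the points off
  the hyperplane.\<close>

lemma divisible_set_exists_iff:
  assumes "CARD('a::{field,finite}) = 2"
  shows "divisible_set_exists TYPE('a) \<Delta> n \<longleftrightarrow> family_exists \<Delta> n"
proof
  assume "divisible_set_exists TYPE('a) \<Delta> n"
  then obtain v and C :: "(nat \<Rightarrow> 'a) set set" where C: "v \<ge> 1" "C \<subseteq> points v" "card C = n" "divisible v \<Delta> C"
    by (auto simp: divisible_set_exists_def)
  then obtain S where S: "S \<subseteq> Pow {..<v} - {{}}" "C = (\<lambda>A. {0, vec A}) ` S"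
    unfolding points_eq[OF assms] by (meson subset_image_iff)
  have fin: "finite S" using S(1) by (meson finite_Diff finite_Pow_iff finite_lessThan finite_subset)
  have dvd: "\<Delta> dvd weight S h" if "finite h" for h
  proof -
    define g where "g = h \<inter> {..<v}"
    have "A \<inter> h = A \<inter> g" if "A \<in> S" for A using S(1) that by (auto simp: g_def)
    then have hg: "weight S h = weight S g" unfolding weight_def by (metis (no_types, lifting))
    show ?thesis
    proof (cases "g = {}")
      \<comment> \<open>A functional that vanishes on all \<open>v\<close> coordinates defines no
        hyperplane, but its weight is 0.\<close>
      case True
      then show ?thesis unfolding hg by (simp add: weight_def)
    next
      case False
      let ?U = "vec ` {A \<in> Pow {..<v}. even (card (A \<inter> g))} :: (nat \<Rightarrow> 'a) set"
      have U: "?U \<in> hyperplanes v" using functional_hyperplane[OF assms _ False] by (simp add: g_def)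
      have "0 \<in> ?U" by (rule image_eqI[of _ _ "{}"]) auto
      then have "card {P \<in> C. P \<subseteq> ?U} = card (section_of S g)"
        unfolding S(2) using S(1) fin by (intro card_points_hyperplane) auto
      moreover have "card C = card S"
        unfolding S(2) by (rule card_image) (auto simp: inj_on_def doubleton_eq_iff)
      moreover have "[card {P \<in> C. P \<subseteq> ?U} = card C] (mod \<Delta>)"
        using C(4) U unfolding divisible_def by blast
      ultimately show ?thesis
        using cong_section_iff[OF fin, of g] hg by simp
    qed
  qed
  have "card S = n"
    using C(3) unfolding S(2) by (subst (asm) card_image) (auto simp: inj_on_def doubleton_eq_iff)
  moreover have "finite A \<and> A \<noteq> {}" if "A \<in> S" for A
    using S(1) that finite_subset[of A "{..<v}"] by auto
  then have "divisible_family \<Delta> S"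
    using fin dvd by (simp add: divisible_family_def)
  ultimately show "family_exists \<Delta> n" unfolding family_exists_def by blast
next
  assume "family_exists \<Delta> n"
  then obtain S :: "nat set set" where S: "divisible_family \<Delta> S" "card S = n"
    by (auto simp: family_exists_def)
  have fin: "finite S" "finite (\<Union>S)" using S(1) by (auto simp: divisible_family_def)
  then obtain k where k: "\<Union>S \<subseteq> {..<k}"
    using finite_nat_set_iff_bounded by (metis lessThan_iff subsetI)
  \<comment> \<open>\<open>Suc\<close> keeps the dimension positive even for
    \<open>k = 0\<close>.\<close>
  define v where "v = Suc k"
  have v: "v \<ge> 1" "\<Union>S \<subseteq> {..<v}" using k by (auto simp: v_def lessThan_Suc)
  define C where "C = (\<lambda>A. {0, vec A :: nat \<Rightarrow> 'a}) ` S"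
  have SV: "S \<subseteq> Pow {..<v}" using v(2) by blast
  have "C \<subseteq> points v"
    using SV S(1) unfolding C_def points_eq[OF assms] by (auto simp: divisible_family_def)
  moreover have cC: "card C = n"
    unfolding C_def S(2)[symmetric] by (rule card_image) (auto simp: inj_on_def doubleton_eq_iff)
  moreover have "divisible v \<Delta> C"
    unfolding divisible_def
  proof
    fix U :: "(nat \<Rightarrow> 'a) set" assume U: "U \<in> hyperplanes v"
    obtain h where h: "h \<subseteq> {..<v}" "\<And>A. A \<subseteq> {..<v} \<Longrightarrow> vec A \<in> U \<longleftrightarrow> even (card (A \<inter> h))"
      using hyperplane_functional[OF assms v(1) U] by blast
    have "0 \<in> U"
      using U by (auto simp: hyperplanes_def subspaces_of_dim_def intro: seq.subspace_0)
    then have "card {P \<in> C. P \<subseteq> U} = card (section_of S h)"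
      unfolding C_def using h SV fin by (intro card_points_hyperplane) auto
    moreover have "\<Delta> dvd weight S h"
      using S(1) finite_subset[OF h(1)] by (simp add: divisible_family_def)
    ultimately show "[card {P \<in> C. P \<subseteq> U} = card C] (mod \<Delta>)"
      using cong_section_iff[OF fin(1)] cC S(2) by metis
  qed
  ultimately show "divisible_set_exists TYPE('a) \<Delta> n"
    using v(1) unfolding divisible_set_exists_def by blast
qed

section \<open>The cardinalities of divisible sets\<close>

lemma family_exists_2:
  assumes "n \<ge> 3"
  shows "family_exists 2 n"
  using assms
proof (induction n rule: less_induct)
  case (less n)
  show ?case
  proof (cases "n < 6")
    case True
    then have "n = 3 \<or> n = 4 \<or> n = 5" using less.prems by arith
    then show ?thesis using family_exists_2_small by blast
  next
    case False
    then show ?thesis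
      using family_exists_add[OF family_exists_2_small(1) less.IH[of "n - 3"]] by simp
  qed
qed

text \<open>For \<open>k = 0\<close> the gap condition is
  \<open>n * (n - 2 * \<Delta> + 1) < 0\<close> over the integers, which excludes every positive
  \<open>n\<close> below \<open>2 * \<Delta> - 1\<close>.\<close>

lemma not_family_exists_2: "\<not> family_exists 2 1" "\<not> family_exists 2 2"
  using not_family_exists_gap[of 2 _ 0] by simp_all

section \<open>Cardinalities of 4-divisible sets\<close>

lemma family_exists_4:
  assumes "n \<in> {7, 8} \<or> n \<ge> 14"
  shows "family_exists 4 n"
  using assms
proof (induction n rule: less_induct)
  case (less n)
  note small = family_exists_4_small
  \<comment> \<open>Sums of 7 and 8 and the switched line spread cover the seven consecutive values
    14 to 20; adding 7 gives the rest.\<close>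
  consider "n \<in> {7, 8}" | "n \<in> {14..16}" | "n \<in> {17..20}" | "n \<ge> 21"
    using less.prems by fastforce
  then show ?case
  proof cases
    case 1
    then show ?thesis using small by auto
  next
    case 2
    then have "n = 14 \<or> n = 15 \<or> n = 16" unfolding atLeastAtMost_iff by arith
    then show ?thesis
      using family_exists_add[OF small(1) small(1)] family_exists_add[OF small(1) small(2)]
        family_exists_add[OF small(2) small(2)] by auto
  next
    case 3
    then have "n - 15 \<in> {2..<6}" "15 + (n - 15) = n" by auto
    then show ?thesis using family_exists_4_switched by metis
  next
    case 4
    then have "n - 7 < n" "n - 7 \<ge> 14" by auto
    then have "family_exists 4 (n - 7)" using less.IH by blast
    then show ?thesis using family_exists_add[OF small(1)] 4 by fastforce
  qed
qed

lemma not_family_exists_4: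
  assumes "n > 0" "n \<notin> {7, 8}" "n < 14"
  shows "\<not> family_exists 4 n"
proof -
  consider "n \<in> {1..6}" | "n \<in> {10..13}" | "n = 9"
    using assms by (cases "n < 7"; cases "n < 10") auto
  then show ?thesis
  proof cases
    case 1
    then have "n \<in> set [1..<7]" unfolding set_upt by simp
    then show ?thesis using not_family_exists_gap[of 4 n 0] by (auto simp: upt_rec)
  next
    case 2
    then have "n \<in> set [10..<14]" unfolding set_upt by simp
    then show ?thesis using not_family_exists_gap[of 4 n 1] by (auto simp: upt_rec)
  next
    case 3
    \<comment> \<open>A small section would be a 2-divisible set with a single point.\<close>
    have "m = 1" if "2 * m < 9" "4 dvd 9 - m" for m :: nat
      using that by presburger
    then show ?thesis
      using family_exists_small_section[of 2 9] not_family_exists_2 3 by auto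
  qed
qed

section \<open>Cardinalities of 8-divisible sets\<close>

lemma family_exists_8_below_60:
  assumes "n \<in> {15, 16, 30, 31, 32, 45, 46, 47, 48, 49, 50, 51}"
  shows "family_exists 8 n"
proof -
  note small = family_exists_8_small
  have two: "family_exists 8 30" "family_exists 8 31" "family_exists 8 32"
    using family_exists_add[OF small(1) small(1)] family_exists_add[OF small(1) small(2)]
      family_exists_add[OF small(2) small(2)] by simp_all
  have "family_exists 8 45" "family_exists 8 46" "family_exists 8 47" "family_exists 8 48"
    using two[THEN family_exists_add[OF small(1)]] family_exists_add[OF small(2) two(3)] by simp_all
  then show ?thesis using assms small two family_exists_8_sporadic by blast
qed

lemma family_exists_8:
  assumes "n \<ge> 60"
  shows "family_exists 8 n"
  using assms
proof (induction n rule: less_induct)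
  case (less n)
  note small = family_exists_8_small
  \<comment> \<open>The first four cases cover fifteen consecutive values, 60 to 74; adding 15 gives
    the rest.\<close>
  consider "n \<in> {60..66}" | "n = 67" | "n \<in> {68..72}" | "n \<in> {73, 74}" | "n \<ge> 75"
    using less.prems by fastforce
  then show ?case
  proof cases
    case 1
    then have "n - 15 \<in> {45, 46, 47, 48, 49, 50, 51}" by auto
    then have "family_exists 8 (n - 15)" by (intro family_exists_8_below_60) auto
    then show ?thesis using family_exists_add[OF small(1)] 1 by fastforce
  next
    case 2
    then show ?thesis using family_exists_add[OF small(2) family_exists_8_sporadic(3)] by simp
  next
    case 3
    then have "n - 63 \<in> {5..<10}" "63 + (n - 63) = n" by auto
    then show ?thesis using family_exists_8_switched by metis
  next
    case 4
    then show ?thesis using family_exists_8_sporadic by auto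
  next
    case 5
    then show ?thesis using family_exists_add[OF small(1) less.IH[of "n - 15"]] by simp
  qed
qed

lemma not_family_exists_8:
  assumes "n > 0" "n \<notin> {15, 16, 30, 31, 32, 45, 46, 47, 48, 49, 50, 51}" "n < 59"
  shows "\<not> family_exists 8 n"
proof -
  \<comment> \<open>Serves 17, 33 and 34, where the quadratic bound fails: the congruence modulo 8
    forces a small section with 1, 2, 9 or 10 points, and none of these is the size of a 4-divisible
    set.\<close>
  have section_8: False if "family_exists 8 n" and "\<And>m. 2 * m < n \<Longrightarrow> 8 dvd n - m \<Longrightarrow> m \<in> {1, 2, 9, 10}"
    using family_exists_small_section[of 4 n] that assms(1) not_family_exists_4 by fastforce
  consider "n \<in> {1..14}" | "n \<in> {18..29}" | "n \<in> {35..44}" | "n \<in> {53..58}"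
    | "n = 17" | "n = 33" | "n = 34" | "n = 52"
    using assms by fastforce
  then show ?thesis
  proof cases
    case 1
    then have "n \<in> set [1..<15]" unfolding set_upt by simp
    then show ?thesis using not_family_exists_gap[of 8 n 0] by (auto simp: upt_rec)
  next
    case 2
    then have "n \<in> set [18..<30]" unfolding set_upt by simp
    then show ?thesis using not_family_exists_gap[of 8 n 1] by (auto simp: upt_rec)
  next
    case 3
    then have "n \<in> set [35..<45]" unfolding set_upt by simp
    then show ?thesis using not_family_exists_gap[of 8 n 2] by (auto simp: upt_rec)
  next
    case 4
    then have "n \<in> set [53..<59]" unfolding set_upt by simp
    then show ?thesis using not_family_exists_gap[of 8 n 3] by (auto simp: upt_rec)
  next
    case 5
    have "m = 1" if "2 * m < 17" "8 dvd 17 - m" for m :: nat using that by presburger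
    then show ?thesis using section_8 5 by blast
  next
    case 6
    have "m = 1 \<or> m = 9" if "2 * m < 33" "8 dvd 33 - m" for m :: nat using that by presburger
    then show ?thesis using section_8 6 by blast
  next
    case 7
    have "m = 2 \<or> m = 10" if "2 * m < 34" "8 dvd 34 - m" for m :: nat using that by presburger
    then show ?thesis using section_8 7 by blast
  next
    case 8
    then show ?thesis using not_family_exists_52 by simp
  qed
qed

text \<open>Any smaller bound would have to cover the missing cardinality \<open>N\<close>.\<close>

lemma frobenius_number_eq:
  assumes "CARD('a::{field,finite}) = 2" "N > 0"
    and "\<And>n. n > N \<Longrightarrow> family_exists (2 ^ r) n" "\<not> family_exists (2 ^ r) N"
  shows "frobenius_number TYPE('a) r = N"
  unfolding frobenius_number_def assms(1) divisible_set_exists_iff[OF assms(1)]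
  using assms(2-4) by (intro Least_equality) (auto simp: not_less[symmetric])

theorem theorem13:
  assumes "CARD('a::{field,finite}) = 2"
  shows
    "((\<forall>n\<ge>3. divisible_set_exists TYPE('a) 2 n) \<and>
      (\<forall>n\<in>{1,2}. \<not> divisible_set_exists TYPE('a) 2 n) \<and>
      frobenius_number TYPE('a) 1 = 2) \<and>
     ((\<forall>n>0. divisible_set_exists TYPE('a) 4 n \<longleftrightarrow> n \<in> {7,8} \<or> n \<ge> 14) \<and>
      frobenius_number TYPE('a) 2 = 13) \<and>
     ((\<forall>n\<in>{15,16,30,31,32,45,46,47,48,49,50,51}. divisible_set_exists TYPE('a) 8 n) \<and>
      (\<forall>n\<ge>60. divisible_set_exists TYPE('a) 8 n) \<and>
      (\<forall>n>0. n \<notin> {15,16,30,31,32,45,46,47,48,49,50,51} \<and> n < 60 \<and> n \<noteq> 59 \<longrightarrow>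
         \<not> divisible_set_exists TYPE('a) 8 n) \<and>
      frobenius_number TYPE('a) 3 \<in> {58,59})"
proof -
  note iff = divisible_set_exists_iff[OF assms]
  have "frobenius_number TYPE('a) 1 = 2"
    using family_exists_2 not_family_exists_2 by (intro frobenius_number_eq[OF assms]) auto
  moreover have "frobenius_number TYPE('a) 2 = 13"
    using family_exists_4 not_family_exists_4[of 13] by (intro frobenius_number_eq[OF assms]) auto
  moreover have "frobenius_number TYPE('a) 3 \<in> {58, 59}"
  \<comment> \<open>58 is missing and everything from 60 on occurs, so the undecided existence for
    59 selects the value.\<close>
  proof (cases "family_exists 8 59")
    case True
    have "family_exists 8 n" if "n > 58" for n
      using True family_exists_8[of n] that by (cases "n = 59") auto
    then have "frobenius_number TYPE('a) 3 = 58"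
      using not_family_exists_8[of 58] by (intro frobenius_number_eq[OF assms]) auto
    then show ?thesis by simp
  next
    case False
    then have "frobenius_number TYPE('a) 3 = 59"
      using family_exists_8 by (intro frobenius_number_eq[OF assms]) auto
    then show ?thesis by simp
  qed
  moreover have "family_exists 4 n \<longleftrightarrow> n \<in> {7, 8} \<or> n \<ge> 14" if "n > 0" for n
    using family_exists_4[of n] not_family_exists_4[of n] that by linarith
  moreover have "\<not> family_exists 8 n"
    if "n > 0" "n \<notin> {15,16,30,31,32,45,46,47,48,49,50,51} \<and> n < 60 \<and> n \<noteq> 59" for n
  proof -
    have "n < 59" using that(2) by linarith
    then show ?thesis using that not_family_exists_8 by blast
  qed
  ultimately show ?thesis
    unfolding iff
    using family_exists_2 not_family_exists_2 family_exists_8_below_60 family_exists_8 by blast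
qed

end
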